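(* Let $G$ be a digraph with vertex set $\{1,2,\dots,n\}$, and let $\overrightarrow{G}=G[S_{m_1},S_{m_2},\dots,S_{m_n}]$ be a generalized join digraph with respect to $G$, where $S_{m_i}$ is an oriented star of order $m_i$ for $1\le i\le n$: $V(S_{m_i})=\{v_i^1,\dots,v_i^{m_i}\}$, $v_i^1$ is the central vertex, and the edges of $S_{m_i}$ are exactly $(v_i^p,v_i^1)$ for $2\le p\le m_i$. Let $i^*\in V(G)$ and set $z_i(\overrightarrow{G})=\sum_{j:\,(i,j)\in E(G)}m_j$ for each $i\in V(G)$. (1) For the central vertex $v_{i^*}^1\in V(S_{m_{i^*}})$, $$t_{v_{i^*}^1}(\overrightarrow{G})=\frac{m_{i^*}+z_{i^*}(\overrightarrow{G})}{m_{i^*}+m_{i^*}z_{i^*}(\overrightarrow{G})}\prod_{i\in V(G)}\left(1+z_i(\overrightarrow{G})\right)^{m_i-1}\sum_{T\in\mathcal{T}_{i^*}(G)}\prod_{(i,j)\in E(T)}m_j .$$ (2) If $2\le p\le m_{i^*}$, then for $v_{i^*}^p\in V(S_{m_{i^*}})$, $$t_{v_{i^*}^p}(\overrightarrow{G})=\frac{z_{i^*}(\overrightarrow{G})}{m_{i^*}+m_{i^*}z_{i^*}(\overrightarrow{G})}\prod_{i\in V(G)}\left(1+z_i(\overrightarrow{G})\right)^{m_i-1}\sum_{T\in\mathcal{T}_{i^*}(G)}\prod_{(i,j)\in E(T)}m_j .$$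
   Context: Digraphs are finite, with nonempty vertex set, without loops or multiple edges (both $(u,v)$ and $(v,u)$ may be edges); $(u,v)$ is directed from $u$ to $v$. Generalized join digraph: $G[H_1,\dots,H_n]$ is obtained from $G$ by replacing each vertex $i$ with $H_i$: its vertex set is the disjoint union $V(H_1)\cup\dots\cup V(H_n)$, the edges inside each $H_i$ are kept, and for $i\ne j$, $u\in V(H_i)$, $v\in V(H_j)$, $(u,v)$ is an edge if and only if $(i,j)\in E(G)$. An oriented spanning tree of a digraph is a subtree containing all its vertices, in which one vertex, the root, has outdegree $0$ and every other vertex has outdegree $1$. $\mathcal{T}_v(G)$ is the set of oriented spanning trees of $G$ with root $v$, and $t_v(G)=|\mathcal{T}_v(G)|$. Empty products equal $1$. *)

theory Defs
  imports Complex_Main "Graph_Theory.Graph_Theory"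
begin

text \<open>
  A digraph in the sense used here (finite, loopless, no parallel arcs, antiparallel arcs
  allowed) is a \<^locale>\<open>pair_digraph\<close>; an arc is the pair of its tail and its head.
\<close>

text \<open>
  The disjoint union of the vertex sets is a dependent sum: the vertex \<open>u\<close> of \<open>H i\<close>
  becomes the pair \<open>(i, u)\<close>.
\<close>
definition generalized_join ::
  "'a pair_pre_digraph \<Rightarrow> ('a \<Rightarrow> 'b pair_pre_digraph) \<Rightarrow> ('a \<times> 'b) pair_pre_digraph" where
  "generalized_join G H =
     \<lparr> pverts = (SIGMA i : pverts G. pverts (H i)),
       parcs = {((i, u), (i, v)) | i u v. i \<in> pverts G \<and> (u, v) \<in> parcs (H i)}
             \<union> {((i, u), (j, v)) | i j u v. i \<in> pverts G \<and> j \<in> pverts G \<and> i \<noteq> j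
                  \<and> u \<in> pverts (H i) \<and> v \<in> pverts (H j) \<and> (i, j) \<in> parcs G} \<rparr>"

definition oriented_star :: "nat \<Rightarrow> nat pair_pre_digraph" where
  "oriented_star k = \<lparr> pverts = {1..k}, parcs = {(p, 1) | p. 2 \<le> p \<and> p \<le> k} \<rparr>"

text \<open>
  The library's \<^const>\<open>tree\<close> requires weak connectedness but only excludes directed cycles.
  Here this is the same as the underlying undirected graph being a tree, since by the
  outdegree conditions \<open>T\<close> has exactly one arc less than it has vertices
  (lemma \<open>oriented_spanning_tree_card_arcs\<close> below).
\<close>
definition oriented_spanning_trees ::
  "'a pair_pre_digraph \<Rightarrow> 'a \<Rightarrow> 'a pair_pre_digraph set" where
  "oriented_spanning_trees G v =
     {T. spanning_tree (with_proj T) (with_proj G)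
       \<and> v \<in> pverts T \<and> out_degree (with_proj T) v = 0
       \<and> (\<forall>u \<in> pverts T - {v}. out_degree (with_proj T) u = 1)}"

definition num_oriented_spanning_trees :: "'a pair_pre_digraph \<Rightarrow> 'a \<Rightarrow> nat" where
  "num_oriented_spanning_trees G v = card (oriented_spanning_trees G v)"

definition out_weight :: "'a pair_pre_digraph \<Rightarrow> ('a \<Rightarrow> nat) \<Rightarrow> 'a \<Rightarrow> nat" where
  "out_weight G m i = (\<Sum>j | (i, j) \<in> parcs G. m j)"

lemma pair_digraph_oriented_star: "pair_digraph (oriented_star k)"
proof -
  have "{(p, Suc 0) |p. 2 \<le> p \<and> p \<le> k} \<subseteq> {1..k} \<times> {1}" by auto
  then have "finite {(p, Suc 0) |p. 2 \<le> p \<and> p \<le> k}" by (rule finite_subset) simp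
  then show ?thesis
    by unfold_locales (auto simp: oriented_star_def)
qed

lemma pair_digraph_generalized_join:
  assumes G: "pair_digraph G" and H: "\<And>i. i \<in> pverts G \<Longrightarrow> pair_digraph (H i)"
  shows "pair_digraph (generalized_join G H)"
proof -
  interpret G: pair_digraph G by (rule G)
  have wf: "u \<in> pverts (H i)" "v \<in> pverts (H i)" "u \<noteq> v"
    if "i \<in> pverts G" "(u, v) \<in> parcs (H i)" for i u v
  proof -
    interpret Hi: pair_digraph "H i" by (rule H) fact
    show "u \<in> pverts (H i)" "v \<in> pverts (H i)" "u \<noteq> v"
      using that Hi.wellformed' Hi.pair_no_loops[of "(u, v)"] by auto
  qed
  have fin: "finite (pverts (H i))" if "i \<in> pverts G" for i
  proof -
    interpret Hi: pair_digraph "H i" by (rule H) fact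
    show ?thesis by (rule Hi.pair_finite_verts)
  qed
  let ?J = "generalized_join G H"
  have finV: "finite (pverts ?J)"
    using fin G.pair_finite_verts by (simp add: generalized_join_def)
  have sub: "parcs ?J \<subseteq> pverts ?J \<times> pverts ?J"
    by (auto simp: generalized_join_def dest: wf)
  have noloop: "fst e \<noteq> snd e" if "e \<in> parcs ?J" for e
    using that by (auto simp: generalized_join_def dest: wf)
  show ?thesis
    using sub noloop finV finite_subset[OF sub]
    by unfold_locales auto
qed

lemma oriented_spanning_tree_card_arcs:
  assumes "pair_digraph G" and T: "T \<in> oriented_spanning_trees G v"
  shows "card (parcs T) + 1 = card (pverts T)"
proof -
  interpret G: pair_digraph G by fact
  have sg: "pverts T = pverts G" "parcs T \<subseteq> parcs G" "wf_digraph (with_proj T)"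
    and v: "v \<in> pverts T" and d0: "out_degree (with_proj T) v = 0"
    and d1: "\<And>u. u \<in> pverts T - {v} \<Longrightarrow> out_degree (with_proj T) u = 1"
    using T by (auto simp: oriented_spanning_trees_def spanning_tree_def spanning_def subgraph_def)
  have finV: "finite (pverts T)" and finA: "finite (parcs T)"
    using sg G.pair_finite_verts G.pair_finite_arcs by (auto intro: finite_subset)
  have arcs: "parcs T = (\<Union>u\<in>pverts T. out_arcs (with_proj T) u)"
    using wf_digraph.tail_in_verts[OF sg(3)] by auto
  have "card (\<Union>u\<in>pverts T. out_arcs (with_proj T) u)
      = (\<Sum>u\<in>pverts T. card (out_arcs (with_proj T) u))"
    using finV finA by (intro card_UN_disjoint) (auto simp: out_arcs_def)
  then have "card (parcs T) = (\<Sum>u\<in>pverts T. out_degree (with_proj T) u)"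
    unfolding out_degree_def arcs[symmetric] .
  also have "\<dots> = (\<Sum>u\<in>pverts T - {v}. out_degree (with_proj T) u)"
    using finV v d0 by (simp add: sum.remove)
  also have "\<dots> = card (pverts T - {v})"
    using d1 by simp
  finally show ?thesis
    using finV v by (metis Suc_eq_plus1 card_Suc_Diff1)
qed

end

theory Submission
  imports Defs
begin

text \<open>
  An oriented spanning tree with root \<open>r\<close> is an acyclic choice of one outgoing arc at every
  \<open>u \<noteq> r\<close>, so weighted counts of such trees are linear in each row of arc weights, and they
  satisfy the row operations of the Laplacian minor (which they equal by the matrix tree theorem,
  not needed here). A leaf of the star \<open>i\<close> sees the same vertices as the centre plus the centre
  itself, so by a row operation it may be attached to the centre at the cost of a factor
  \<open>1 + z\<^sub>i\<close>; if the centre is the root, the leaves of its star are attached to one of them instead.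
  This leaves \<open>G\<close> with arc weights \<open>m\<^sub>j\<close>, in which only \<open>i\<^sup>*\<close> may still be doubled: arcs into it reach
  the root and the other representative in the ratio \<open>1 : m - 1\<close>, which produces the factor
  \<open>(m + z) / m\<close> or \<open>z / m\<close>.
\<close>

section \<open>Weighted sums over rooted forests\<close>

definition farcs :: "'a set \<Rightarrow> ('a \<Rightarrow> 'a) \<Rightarrow> 'a rel" where
  "farcs S f = (\<lambda>u. (u, f u)) ` S"

text \<open>
  The vertices of \<open>S\<close> choose their out-neighbours in \<open>T\<close>, and those of \<open>T - S\<close> are the roots.
  The arcs \<open>R\<close> are chosen in advance, which makes expansion along a row recursive.
\<close>
definition forest_sum :: "'a rel \<Rightarrow> 'a set \<Rightarrow> 'a set \<Rightarrow> ('a \<Rightarrow> 'a \<Rightarrow> real) \<Rightarrow> real" where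
  "forest_sum R T S w =
     (\<Sum>f\<in>S \<rightarrow>\<^sub>E T. of_bool (acyclic (R \<union> farcs S f)) * (\<Prod>u\<in>S. w u (f u)))"

section \<open>Expansion along a row and linearity in it\<close>

lemma forest_sum_cong:
  assumes "\<And>u v. u \<in> S \<Longrightarrow> v \<in> T \<Longrightarrow> w u v = w' u v"
  shows "forest_sum R T S w = forest_sum R T S w'"
  unfolding forest_sum_def by (intro sum.cong refl arg_cong2[where f="(*)"] prod.cong) (use assms in auto)

lemma forest_sum_insert:
  assumes "finite S" "x \<notin> S"
  shows "forest_sum R T (insert x S) w = (\<Sum>v\<in>T. w x v * forest_sum (insert (x, v) R) T S w)"
proof -
  have inj: "inj_on (\<lambda>(v, g). g(x := v)) (T \<times> (S \<rightarrow>\<^sub>E T))"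
    using inj_combinator[OF assms(2), of "\<lambda>_. T"] by simp
  have arcs: "farcs (insert x S) (g(x := v)) = insert (x, v) (farcs S g)" for g v
    using assms(2) by (auto simp: farcs_def)
  have prod: "(\<Prod>u\<in>S. w u ((g(x := v)) u)) = (\<Prod>u\<in>S. w u (g u))" for g v
    using assms(2) by (intro prod.cong) auto
  have "forest_sum R T (insert x S) w = (\<Sum>(v, g)\<in>T \<times> (S \<rightarrow>\<^sub>E T).
      of_bool (acyclic (R \<union> insert (x, v) (farcs S g))) * (w x v * (\<Prod>u\<in>S. w u (g u))))"
    unfolding forest_sum_def PiE_insert_eq
    by (subst sum.reindex[OF inj], intro sum.cong refl)
       (auto simp: arcs assms prod simp del: fun_upd_apply Un_insert_right, auto)
  also have "\<dots> = (\<Sum>v\<in>T. w x v * forest_sum (insert (x, v) R) T S w)"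
    unfolding forest_sum_def sum_distrib_left sum.cartesian_product
    by (intro sum.cong refl) (auto simp: algebra_simps)
  finally show ?thesis .
qed

text \<open>After expansion along \<open>x\<close>, the weights of row \<open>x\<close> occur only
  as coefficients; the remaining forest sums do not see this row.\<close>

lemma forest_sum_linear:
  assumes "finite S" "x \<in> S"
  shows "forest_sum R T S (w(x := (\<lambda>v. a * p v + b * q v)))
       = a * forest_sum R T S (w(x := p)) + b * forest_sum R T S (w(x := q))"
proof -
  obtain S' where S: "S = insert x S'" "x \<notin> S'" "finite S'"
    using assms by (metis finite_Diff insert_Diff insert_Diff_single Diff_iff singletonI)
  have c: "forest_sum R' T S' (w(x := p)) = forest_sum R' T S' w" for R' p
    using S by (intro forest_sum_cong) auto
  show ?thesis
    unfolding S(1) forest_sum_insert[OF S(3,2)] c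
    by (simp add: sum_distrib_left sum.distrib algebra_simps)
qed

lemma forest_sum_row:
  assumes "finite S" "x \<in> S" "finite T"
  shows "forest_sum R T S w = (\<Sum>v\<in>T. w x v * forest_sum R T S (w(x := (\<lambda>t. of_bool (t = v)))))"
proof -
  obtain S' where S: "S = insert x S'" "x \<notin> S'" "finite S'"
    using assms by (metis finite_Diff insert_Diff insert_Diff_single Diff_iff singletonI)
  have c: "forest_sum R' T S' (w(x := p)) = forest_sum R' T S' w" for R' p
    using S by (intro forest_sum_cong) auto
  show ?thesis
    unfolding S(1) forest_sum_insert[OF S(3,2)] c
    by (intro sum.cong refl) (simp add: assms of_bool_def if_distrib[of "\<lambda>c. c * _"] cong: if_cong)
qed

section \<open>Exchanging a row for a certain step\<close>

text \<open>In \<open>R\<close> the vertices \<open>x\<close> and \<open>y\<close> have no outgoing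
  arc and all others at most one, so a walk reaches at most one of the two. If \<open>R\<close> is
  cyclic, all terms vanish; otherwise both sides count how many of \<open>u\<close> and
  \<open>v\<close> lead in \<open>R\<close> to neither \<open>x\<close> nor
  \<open>y\<close>.\<close>

lemma acyclic_two_rows:
  assumes "x \<noteq> y" "x \<notin> S" "y \<notin> S" and R: "R = farcs S f"
  shows "of_bool (acyclic (insert (x, v) (insert (y, u) R))) + of_bool (acyclic (insert (x, u) (insert (y, v) R)))
       = (of_bool (acyclic (insert (x, y) (insert (y, v) R))) + of_bool (acyclic (insert (x, y) (insert (y, u) R))) :: real)"
proof -
  have sv: "single_valued R" by (auto simp: R farcs_def single_valued_def)
  have out: "(s, t) \<in> R\<^sup>* \<longleftrightarrow> s = t" if "s \<notin> S" for s t
    using that by (auto simp: R farcs_def elim: converse_rtranclE)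
  have excl: "\<not> ((s, x) \<in> R\<^sup>* \<and> (s, y) \<in> R\<^sup>*)" for s
    using single_valued_confluent[OF sv, of s x y] out assms by metis
  show ?thesis
    using excl[of u] excl[of v] \<open>x \<noteq> y\<close> out[OF \<open>x \<notin> S\<close>] out[OF \<open>y \<notin> S\<close>]
    by (auto simp: rtrancl_insert)
qed

text \<open>
  This is a row operation on the Laplacian: stepping from \<open>x\<close> to \<open>y\<close> with certainty is, up to the
  total weight of row \<open>y\<close>, the same as stepping from \<open>x\<close> according to row \<open>y\<close>.
\<close>
lemma forest_sum_exchange:
  assumes "finite S" "x \<in> S" "y \<in> S" "x \<noteq> y" "finite T" "y \<in> T"
  shows "forest_sum {} T S (w(x := w y))
       = (\<Sum>v\<in>T. w y v) * forest_sum {} T S (w(x := (\<lambda>v. of_bool (v = y))))"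
proof -
  define S' where "S' = S - {x, y}"
  have S: "S = insert x (insert y S')" "x \<notin> insert y S'" "y \<notin> S'" "x \<notin> S'" "finite S'" "finite (insert y S')"
    using assms by (auto simp: S'_def)
  define \<rho> where "\<rho> = w y"
  define A where "A v u = forest_sum {(x, v), (y, u)} T S' w" for v u
  have c: "forest_sum R T S' (w(x := p)) = forest_sum R T S' w" for R p
    using S by (intro forest_sum_cong) auto
  have expand: "forest_sum {} T S (w(x := p)) = (\<Sum>v\<in>T. \<Sum>u\<in>T. p v * \<rho> u * A v u)" for p
    unfolding S(1) forest_sum_insert[OF S(6,2)] forest_sum_insert[OF S(5,3)] c A_def
    using \<open>x \<noteq> y\<close> by (simp add: sum_distrib_left \<rho>_def mult.assoc insert_commute)
  have symm: "A v u + A u v = A y v + A y u" for v u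
    unfolding A_def forest_sum_def sum.distrib[symmetric]
    using S \<open>x \<noteq> y\<close> acyclic_two_rows[OF _ S(4,3) refl, of v u]
    by (intro sum.cong refl) (simp add: distrib_right[symmetric] insert_commute)
  have lhs: "forest_sum {} T S (w(x := w y)) = (\<Sum>v\<in>T. \<Sum>u\<in>T. \<rho> v * \<rho> u * A v u)" (is "_ = ?L")
    unfolding expand by (simp add: \<rho>_def)
  have swap: "?L = (\<Sum>v\<in>T. \<Sum>u\<in>T. \<rho> v * \<rho> u * A u v)"
    by (subst sum.swap) (simp add: mult.commute)
  have rhs: "(\<Sum>v\<in>T. \<Sum>u\<in>T. \<rho> v * \<rho> u * A y u) = (\<Sum>v\<in>T. \<rho> v) * (\<Sum>u\<in>T. \<rho> u * A y u)" (is "?R = _")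
    by (simp add: sum_product mult.assoc)
  \<comment> \<open>The weight \<open>\<rho> v * \<rho> u\<close> is symmetric, so doubling the sum
    symmetrises \<open>A\<close>; \<open>symm\<close> then leaves only terms in which
    \<open>x\<close> steps to \<open>y\<close>.\<close>
  have "2 * ?L = (\<Sum>v\<in>T. \<Sum>u\<in>T. \<rho> v * \<rho> u * (A v u + A u v))"
    using swap by (simp add: sum.distrib distrib_left)
  also have "\<dots> = (\<Sum>v\<in>T. \<Sum>u\<in>T. \<rho> v * \<rho> u * A y v) + ?R"
    unfolding symm by (simp add: sum.distrib distrib_left)
  also have "(\<Sum>v\<in>T. \<Sum>u\<in>T. \<rho> v * \<rho> u * A y v) = ?R"
    by (subst sum.swap) (simp add: mult.commute)
  finally have "?L = (\<Sum>v\<in>T. \<rho> v) * (\<Sum>u\<in>T. \<rho> u * A y u)"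
    unfolding rhs by simp
  moreover have "forest_sum {} T S (w(x := (\<lambda>v. of_bool (v = y)))) = (\<Sum>u\<in>T. \<rho> u * A y u)"
    unfolding expand using assms
    by (subst sum.swap) (simp add: of_bool_def if_distrib[of "\<lambda>c. c * _"] cong: if_cong)
  ultimately show ?thesis
    unfolding lhs by (simp add: \<rho>_def)
qed

section \<open>Eliminating and merging vertices\<close>

lemma forest_sum_mono_target:
  assumes "finite T" "T' \<subseteq> T" "\<And>u v. u \<in> S \<Longrightarrow> v \<in> T - T' \<Longrightarrow> w u v = 0" "finite S"
  shows "forest_sum R T S w = forest_sum R T' S w"
  unfolding forest_sum_def
proof (rule sum.mono_neutral_right)
  show "finite (S \<rightarrow>\<^sub>E T)" using assms by (simp add: finite_PiE)
  show "S \<rightarrow>\<^sub>E T' \<subseteq> S \<rightarrow>\<^sub>E T" using assms by (intro PiE_mono) auto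
  show "\<forall>f\<in>(S \<rightarrow>\<^sub>E T) - (S \<rightarrow>\<^sub>E T').
      of_bool (acyclic (R \<union> farcs S f)) * (\<Prod>u\<in>S. w u (f u)) = 0"
  proof
    fix f assume f: "f \<in> (S \<rightarrow>\<^sub>E T) - (S \<rightarrow>\<^sub>E T')"
    then obtain u where "u \<in> S" "f u \<in> T - T'" by (auto simp: PiE_iff)
    then have "(\<Prod>u\<in>S. w u (f u)) = 0" using assms by (intro prod_zero) auto
    then show "of_bool (acyclic (R \<union> farcs S f)) * (\<Prod>u\<in>S. w u (f u)) = 0" by simp
  qed
qed

text \<open>No other vertex steps to \<open>y\<close>, so \<open>y\<close> lies on no cycle except
  its own loop, and its step can be chosen freely among the other vertices.\<close>

lemma forest_sum_source:
  assumes "finite T" "S \<subseteq> T" "y \<in> S" "\<And>u. u \<in> S - {y} \<Longrightarrow> w u y = 0"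
  shows "forest_sum {} T S w = (\<Sum>v\<in>T - {y}. w y v) * forest_sum {} (T - {y}) (S - {y}) w"
proof -
  define S' where "S' = S - {y}"
  have S: "S = insert y S'" "y \<notin> S'" "finite S'" and fin: "finite S"
    using assms by (auto simp: S'_def intro: finite_subset)
  have restr: "forest_sum R T S' w = forest_sum R (T - {y}) S' w" for R
    by (rule forest_sum_mono_target) (use assms S in auto)
  have loop: "forest_sum {(y, y)} T S' w = 0"
    unfolding forest_sum_def by (intro sum.neutral) auto
  have noloop: "forest_sum {(y, v)} (T - {y}) S' w = forest_sum {} (T - {y}) S' w" if "v \<noteq> y" for v
    unfolding forest_sum_def
  proof (intro sum.cong refl)
    fix f assume f: "f \<in> S' \<rightarrow>\<^sub>E (T - {y})"
    have "(v, y) \<notin> (farcs S' f)\<^sup>*"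
      using f that by (auto simp: farcs_def elim: rtranclE)
    then show "of_bool (acyclic ({(y, v)} \<union> farcs S' f)) * (\<Prod>u\<in>S'. w u (f u)) =
        of_bool (acyclic ({} \<union> farcs S' f)) * (\<Prod>u\<in>S'. w u (f u))" by simp
  qed
  have "forest_sum {} T S w = (\<Sum>v\<in>T. w y v * forest_sum {(y, v)} T S' w)"
    unfolding S(1) forest_sum_insert[OF S(3,2)] by simp
  also have "\<dots> = (\<Sum>v\<in>T - {y}. w y v * forest_sum {(y, v)} T S' w)"
    using loop assms by (subst sum.remove[of T y]) auto
  also have "\<dots> = (\<Sum>v\<in>T - {y}. w y v * forest_sum {} (T - {y}) S' w)"
    using restr noloop by (intro sum.cong refl) auto
  finally show ?thesis
    by (simp add: sum_distrib_right S'_def)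
qed

text \<open>Following an acyclic choice inside the finite set \<open>S\<close> ends at a vertex
  whose chosen arc leaves \<open>S\<close>, and that arc has weight zero.\<close>

lemma forest_sum_no_exit:
  assumes "finite S" "S \<noteq> {}" "\<And>u v. u \<in> S \<Longrightarrow> v \<in> T - S \<Longrightarrow> w u v = 0"
  shows "forest_sum {} T S w = 0"
  unfolding forest_sum_def
proof (intro sum.neutral ballI)
  fix f assume f: "f \<in> S \<rightarrow>\<^sub>E T"
  show "of_bool (acyclic ({} \<union> farcs S f)) * (\<Prod>u\<in>S. w u (f u)) = 0"
  proof (cases "acyclic (farcs S f)")
    case True
    have "wf ((farcs S f)\<inverse>)"
      using True assms(1) by (intro finite_acyclic_wf_converse) (auto simp: farcs_def)
    from wfE_min'[OF this assms(2)] obtain z where z: "z \<in> S" "\<And>y. (y, z) \<in> (farcs S f)\<inverse> \<Longrightarrow> y \<notin> S"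
      by metis
    then have "f z \<in> T - S" using f by (auto simp: farcs_def PiE_iff)
    then have "(\<Prod>u\<in>S. w u (f u)) = 0" using assms z by (intro prod_zero) auto
    then show ?thesis by simp
  qed simp
qed

text \<open>Each arc into \<open>y\<close> is exchanged for a multiple of row \<open>y\<close>; then
  no other vertex enters \<open>y\<close>, and it splits off as a source. This is a Schur
  complement, with the weights into \<open>y\<close> written as multiples of the row total to avoid
  a division.\<close>

lemma forest_sum_eliminate:
  assumes T: "finite T" "S \<subseteq> T" "y \<in> S" "w y y = 0"
    and c: "\<And>u. u \<in> S - {y} \<Longrightarrow> w u y = c u * (\<Sum>v\<in>T. w y v)"
  shows "forest_sum {} T S w
       = (\<Sum>v\<in>T. w y v) * forest_sum {} (T - {y}) (S - {y}) (\<lambda>u v. w u v + c u * w y v)"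
proof -
  have fin: "finite S" using T finite_subset by blast
  \<comment> \<open>In \<open>g U\<close> the rows of \<open>U\<close> have already been rerouted
    past \<open>y\<close>.\<close>
  define g where "g U = (\<lambda>u. if u \<in> U then (\<lambda>v. (if v = y then 0 else w u v) + c u * w y v) else w u)" for U
  have step: "forest_sum {} T S w = forest_sum {} T S (g U)" if "finite U" "U \<subseteq> S - {y}" for U
    using that
  proof (induction U rule: finite_induct)
    case empty
    then show ?case by (simp add: g_def)
  next
    case (insert x U)
    let ?p = "\<lambda>v. if v = y then 0 else w x v"
    have x: "x \<in> S" "x \<noteq> y" "y \<notin> U" using insert.prems by auto
    have gy: "g U y = w y" using x by (simp add: g_def)
    have "g U = (g U)(x := (\<lambda>v. 1 * ?p v + (c x * (\<Sum>v\<in>T. w y v)) * of_bool (v = y)))"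
      using c[of x] x insert.hyps by (auto simp: g_def fun_eq_iff)
    then have "forest_sum {} T S (g U) = 1 * forest_sum {} T S ((g U)(x := ?p)) +
        (c x * (\<Sum>v\<in>T. w y v)) * forest_sum {} T S ((g U)(x := (\<lambda>v. of_bool (v = y))))"
      using forest_sum_linear[OF fin x(1)] by metis
    also have "\<dots> = 1 * forest_sum {} T S ((g U)(x := ?p)) + c x * forest_sum {} T S ((g U)(x := g U y))"
      using forest_sum_exchange[OF fin x(1) T(3) x(2) T(1), of "g U"] T by (auto simp: gy)
    also have "\<dots> = forest_sum {} T S ((g U)(x := (\<lambda>v. 1 * ?p v + c x * g U y v)))"
      by (rule forest_sum_linear[OF fin x(1), symmetric])
    also have "(g U)(x := (\<lambda>v. 1 * ?p v + c x * g U y v)) = g (insert x U)"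
      using x by (auto simp: g_def fun_eq_iff)
    finally show ?case using insert by auto
  qed
  have "forest_sum {} T S w = forest_sum {} T S (g (S - {y}))"
    using fin by (intro step) auto
  also have "\<dots> = (\<Sum>v\<in>T - {y}. g (S - {y}) y v) * forest_sum {} (T - {y}) (S - {y}) (g (S - {y}))"
    using T by (intro forest_sum_source) (auto simp: g_def)
  also have "forest_sum {} (T - {y}) (S - {y}) (g (S - {y}))
      = forest_sum {} (T - {y}) (S - {y}) (\<lambda>u v. w u v + c u * w y v)"
    by (rule forest_sum_cong) (auto simp: g_def)
  also have "(\<Sum>v\<in>T - {y}. g (S - {y}) y v) = (\<Sum>v\<in>T. w y v)"
    using T sum.remove[of T y "w y"] by (auto simp: g_def)
  finally show ?thesis .
qed

text \<open>Row \<open>x\<close> has total one, so eliminating \<open>x\<close> with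
  \<open>c u = w u x\<close> redirects every arc into \<open>x\<close> to \<open>y\<close>.\<close>

lemma forest_sum_contract:
  assumes "finite T" "S \<subseteq> T" "x \<in> S" "y \<in> T" "x \<noteq> y"
  shows "forest_sum {} T S (w(x := (\<lambda>v. of_bool (v = y))))
       = forest_sum {} (T - {x}) (S - {x}) (\<lambda>u v. w u v + of_bool (v = y) * w u x)"
proof -
  have "(\<Sum>v\<in>T. of_bool (v = y)) = (1::real)" using assms by (simp add: of_bool_def)
  then show ?thesis
    using assms
    by (subst forest_sum_eliminate[where y = x and c = "\<lambda>u. w u x"])
       (auto intro!: forest_sum_cong simp: mult.commute)
qed

text \<open>By linearity and the exchange, both summands of row \<open>x\<close> become multiples of
  the certain step from \<open>x\<close> to \<open>y\<close>, which then contracts.\<close>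

lemma forest_sum_absorb:
  assumes T: "finite T" "S \<subseteq> T" "x \<in> S" "y \<in> S" "x \<noteq> y"
    and row: "\<And>v. v \<in> T \<Longrightarrow> w x v = b * of_bool (v = y) + w y v"
  shows "forest_sum {} T S w
       = (b + (\<Sum>v\<in>T. w y v)) * forest_sum {} (T - {x}) (S - {x}) (\<lambda>u v. w u v + of_bool (v = y) * w u x)"
proof -
  have fin: "finite S" using T finite_subset by blast
  have "forest_sum {} T S w = forest_sum {} T S (w(x := (\<lambda>v. b * of_bool (v = y) + 1 * w y v)))"
    using row by (intro forest_sum_cong) auto
  also have "\<dots> = (b + (\<Sum>v\<in>T. w y v)) * forest_sum {} T S (w(x := (\<lambda>v. of_bool (v = y))))"
    unfolding forest_sum_linear[OF fin T(3)]
    using forest_sum_exchange[OF fin T(3,4,5,1), of w] T by (simp add: algebra_simps subset_iff)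
  also have "forest_sum {} T S (w(x := (\<lambda>v. of_bool (v = y))))
      = forest_sum {} (T - {x}) (S - {x}) (\<lambda>u v. w u v + of_bool (v = y) * w u x)"
    using T by (intro forest_sum_contract) auto
  finally show ?thesis .
qed

text \<open>The vertices of \<open>X\<close> are absorbed one at a time. Each absorption moves
  column \<open>x\<close> onto column \<open>c x\<close>, which keeps the row totals and the
  relations between the remaining rows of \<open>X\<close> and those of their
  representatives.\<close>

lemma forest_sum_collapse:
  assumes "finite X" "finite T" "S \<subseteq> T" "X \<subseteq> S" "\<And>x. x \<in> X \<Longrightarrow> c x \<in> S - X"
    and "\<And>x v. x \<in> X \<Longrightarrow> v \<in> T \<Longrightarrow> w x v = b x * of_bool (v = c x) + w (c x) v"
  shows "forest_sum {} T S w = (\<Prod>x\<in>X. b x + (\<Sum>v\<in>T. w (c x) v))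
       * forest_sum {} (T - X) (S - X) (\<lambda>u v. w u v + (\<Sum>x | x \<in> X \<and> c x = v. w u x))"
  using assms
proof (induction X arbitrary: T S w rule: finite_induct)
  case empty
  then show ?case by simp
next
  case (insert x X)
  define w' where "w' = (\<lambda>u v. w u v + of_bool (v = c x) * w u x)"
  have x: "x \<in> S" "c x \<in> S" "x \<noteq> c x" "x \<in> T" "c x \<in> T"
    using insert.prems(1-3) insert.prems(4)[of x] by auto
  have tot: "(\<Sum>v\<in>T - {x}. w' u v) = (\<Sum>v\<in>T. w u v)" for u
  proof -
    have "(\<Sum>v\<in>T - {x}. w' u v) = (\<Sum>v\<in>T - {x}. w u v) + w u x"
      using x insert.prems by (simp add: w'_def sum.distrib of_bool_def if_distrib[of "\<lambda>c. c * _"] cong: if_cong)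
    then show ?thesis using sum.remove[OF insert.prems(1) x(4), of "w u"] by simp
  qed
  \<comment> \<open>Columns \<open>x\<close> and \<open>c x\<close> of the relation are added; the
    term \<open>b y\<close> is absent from column \<open>x\<close>, since representatives lie
    outside \<open>insert x X\<close>.\<close>
  have row: "w' y v = b y * of_bool (v = c y) + w' (c y) v" if "y \<in> X" "v \<in> T - {x}" for y v
  proof -
    have "w y v = b y * of_bool (v = c y) + w (c y) v" "w y x = b y * of_bool (x = c y) + w (c y) x"
      using insert.prems(5) that x by auto
    moreover have "x \<noteq> c y" using insert.prems(4)[of y] that by auto
    ultimately show ?thesis by (simp add: w'_def algebra_simps)
  qed
  have "forest_sum {} T S w = (b x + (\<Sum>v\<in>T. w (c x) v)) * forest_sum {} (T - {x}) (S - {x}) w'"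
    unfolding w'_def using insert.prems x by (intro forest_sum_absorb) auto
  also have "forest_sum {} (T - {x}) (S - {x}) w' = (\<Prod>y\<in>X. b y + (\<Sum>v\<in>T - {x}. w' (c y) v)) *
      forest_sum {} (T - {x} - X) (S - {x} - X) (\<lambda>u v. w' u v + (\<Sum>y | y \<in> X \<and> c y = v. w' u y))"
    using insert.prems insert.hyps row by (intro insert.IH) auto
  also have "forest_sum {} (T - {x} - X) (S - {x} - X) (\<lambda>u v. w' u v + (\<Sum>y | y \<in> X \<and> c y = v. w' u y))
     = forest_sum {} (T - insert x X) (S - insert x X) (\<lambda>u v. w u v + (\<Sum>y | y \<in> insert x X \<and> c y = v. w u y))"
  proof -
    have "w' u v + (\<Sum>y | y \<in> X \<and> c y = v. w' u y) = w u v + (\<Sum>y | y \<in> insert x X \<and> c y = v. w u y)" for u v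
    proof -
      have "(\<Sum>y | y \<in> X \<and> c y = v. w' u y) = (\<Sum>y | y \<in> X \<and> c y = v. w u y)"
        using insert.prems(4) by (intro sum.cong refl) (auto simp: w'_def)
      moreover have "{y. y \<in> insert x X \<and> c y = v} = (if c x = v then insert x {y. y \<in> X \<and> c y = v} else {y. y \<in> X \<and> c y = v})"
        by auto
      ultimately show ?thesis
        using insert.hyps by (auto simp: w'_def)
    qed
    moreover have "T - {x} - X = T - insert x X" "S - {x} - X = S - insert x X" by auto
    ultimately show ?thesis by simp
  qed
  finally show ?case
    using insert.hyps by (simp add: tot mult.assoc)
qed

section \<open>Arcs shared between the root and one other vertex\<close>

text \<open>
  Arcs enter \<open>x\<close> and the root \<open>r\<close> in the fixed ratio \<open>a : b\<close>. Splitting them at an auxiliary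
  vertex \<open>s\<close> shows that a path from any vertex of \<open>S - {x}\<close> meets \<open>r\<close> before \<open>x\<close> with proportion
  \<open>b / (a + b)\<close>.
\<close>
lemma forest_sum_hub:
  assumes S: "finite S" "r \<notin> S" "x \<in> S" "s \<notin> insert r S" "w x x = 0"
    and rows: "\<And>u. u \<in> S \<Longrightarrow> u \<noteq> x \<Longrightarrow> w u x = a * \<alpha> u" "\<And>u. u \<in> S \<Longrightarrow> u \<noteq> x \<Longrightarrow> w u r = b * \<alpha> u"
  shows "(a + b) * forest_sum {} (insert r S) S w
       = ((a + b) * w x r + b * (\<Sum>v\<in>S - {x}. w x v)) *
         forest_sum {} (insert r (S - {x})) (S - {x}) (\<lambda>u v. if v = r then (a + b) * \<alpha> u else w u v)"
    (is "_ = _ * ?F")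
proof -
  have neq: "r \<noteq> x" "s \<noteq> x" "s \<noteq> r" "s \<notin> S" using S by auto
  let ?\<delta> = "\<lambda>y v. of_bool (v = y) :: real"
  let ?R = "\<lambda>y. forest_sum {} (insert r S) S (w(x := ?\<delta> y))"
  have root: "?R r = ?F"
  proof -
    have "?R r = forest_sum {} (insert r S - {x}) (S - {x}) (\<lambda>u v. w u v + of_bool (v = r) * w u x)"
      using S neq by (intro forest_sum_contract) auto
    also have "insert r S - {x} = insert r (S - {x})" using neq by auto
    also have "forest_sum {} (insert r (S - {x})) (S - {x}) (\<lambda>u v. w u v + of_bool (v = r) * w u x) = ?F"
      by (rule forest_sum_cong) (simp add: rows algebra_simps)
    finally show ?thesis .
  qed
  have nonroot: "(a + b) * ?R y = b * ?F" if y: "y \<in> S - {x}" for y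
  proof -
    \<comment> \<open>Here \<open>x\<close> steps to \<open>y\<close> with certainty, and the arcs
      from any other vertex of \<open>S\<close> into \<open>x\<close> and \<open>r\<close> are
      bundled into one arc to \<open>s\<close>.\<close>
    define g where "g = (\<lambda>u. if u = x then ?\<delta> y else
        (\<lambda>v. if v = s then (a + b) * \<alpha> u else if v = x \<or> v = r then 0 else w u v))"
    let ?T = "insert s (insert r S)" and ?S = "insert s S"
    let ?row = "\<lambda>v. a * ?\<delta> x v + b * ?\<delta> r v"
    have yn: "y \<noteq> r" "y \<noteq> s" "y \<noteq> x" "y \<in> S" using y S by auto
    have tot: "(\<Sum>v\<in>?T. ?row v) = a + b"
      using S neq by (simp add: sum.distrib of_bool_def if_distrib[of "\<lambda>c. _ * c"] cong: if_cong)
    \<comment> \<open>If \<open>s\<close> passes on to \<open>x\<close> and \<open>r\<close> with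
      weights \<open>a\<close> and \<open>b\<close>, eliminating it restores the original arcs at
      the cost of a factor \<open>a + b\<close>.\<close>
    have "forest_sum {} ?T ?S (g(s := ?row)) = (\<Sum>v\<in>?T. (g(s := ?row)) s v) *
        forest_sum {} (?T - {s}) (?S - {s})
          (\<lambda>u v. (g(s := ?row)) u v + (if u = x then 0 else \<alpha> u) * (g(s := ?row)) s v)"
      using S neq yn tot by (intro forest_sum_eliminate) (auto simp: g_def)
    also have "\<dots> = (a + b) * ?R y"
      unfolding fun_upd_same tot using S neq yn rows
      by (intro arg_cong2[where f = "(*)"] refl) (auto intro!: forest_sum_cong simp: g_def)
    finally have "(a + b) * ?R y = forest_sum {} ?T ?S (g(s := ?row))" ..
    also have "\<dots> = a * forest_sum {} ?T ?S (g(s := ?\<delta> x)) + b * forest_sum {} ?T ?S (g(s := ?\<delta> r))"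
      using S by (intro forest_sum_linear) auto
    \<comment> \<open>With \<open>s\<close> stepping to \<open>x\<close>, no arc of nonzero weight
      leads to the root.\<close>
    also have "forest_sum {} ?T ?S (g(s := ?\<delta> x)) = 0"
      using S neq yn by (intro forest_sum_no_exit) (auto simp: g_def)
    \<comment> \<open>With \<open>s\<close> stepping to \<open>r\<close>, nothing enters
      \<open>x\<close>, so \<open>x\<close> splits off as a source of total weight one; afterwards
      \<open>s\<close> contracts into the root.\<close>
    also have "forest_sum {} ?T ?S (g(s := ?\<delta> r)) = ?F"
    proof -
      have one: "(\<Sum>v\<in>?T - {x}. (g(s := ?\<delta> r)) x v) = 1"
        using S neq yn by (simp add: g_def of_bool_def)
      have "forest_sum {} ?T ?S (g(s := ?\<delta> r)) = (\<Sum>v\<in>?T - {x}. (g(s := ?\<delta> r)) x v) *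
          forest_sum {} (?T - {x}) (?S - {x}) (g(s := ?\<delta> r))"
        using S neq yn by (intro forest_sum_source) (auto simp: g_def)
      also have "\<dots> = forest_sum {} (?T - {x} - {s}) (?S - {x} - {s}) (\<lambda>u v. g u v + of_bool (v = r) * g u s)"
        unfolding one mult_1 using S neq by (intro forest_sum_contract) auto
      also have "?T - {x} - {s} = insert r (S - {x})" using S neq by auto
      also have "?S - {x} - {s} = S - {x}" using neq by auto
      also have "forest_sum {} (insert r (S - {x})) (S - {x}) (\<lambda>u v. g u v + of_bool (v = r) * g u s) = ?F"
        using S neq by (intro forest_sum_cong) (auto simp: g_def)
      finally show ?thesis .
    qed
    finally show ?thesis unfolding mult_zero_right add_0_left .
  qed
  \<comment> \<open>Condition on the step out of \<open>x\<close>: to \<open>r\<close> it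
    contributes \<open>?F\<close> in full, to another vertex only the proportion found in
    \<open>nonroot\<close>.\<close>
  have "forest_sum {} (insert r S) S w = (\<Sum>v\<in>insert r S. w x v * ?R v)"
    using S by (intro forest_sum_row) auto
  also have "\<dots> = w x r * ?F + (\<Sum>v\<in>S - {x}. w x v * ?R v)"
    using S root by (simp add: sum.remove[of S x])
  finally have "(a + b) * forest_sum {} (insert r S) S w
      = (a + b) * w x r * ?F + (\<Sum>v\<in>S - {x}. w x v * ((a + b) * ?R v))"
    by (simp add: distrib_left sum_distrib_left mult_ac)
  also have "\<dots> = (a + b) * w x r * ?F + (\<Sum>v\<in>S - {x}. w x v * (b * ?F))"
    by (simp add: nonroot)
  finally show ?thesis
    by (simp add: sum_distrib_left sum_distrib_right algebra_simps)
qed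

section \<open>Relabelling of vertices\<close>

lemma acyclic_reindex:
  assumes "inj_on \<phi> T" "R \<subseteq> T \<times> T"
  shows "acyclic (map_prod \<phi> \<phi> ` R) \<longleftrightarrow> acyclic R"
proof -
  define \<psi> where "\<psi> = the_inv_into T \<phi>"
  have \<psi>: "\<psi> (\<phi> t) = t" if "t \<in> T" for t
    using the_inv_into_f_f[OF assms(1) that] by (simp add: \<psi>_def)
  have "(\<phi> a, \<phi> b) \<in> (map_prod \<phi> \<phi> ` R)\<^sup>+" if "(a, b) \<in> R\<^sup>+" for a b
    using that by (induction rule: trancl_induct) (auto intro: trancl_into_trancl rev_image_eqI)
  moreover have "(\<psi> a, \<psi> b) \<in> R\<^sup>+" if "(a, b) \<in> (map_prod \<phi> \<phi> ` R)\<^sup>+" for a b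
    using that
  proof (induction rule: trancl_induct)
    case (base y)
    then show ?case using assms(2) \<psi> by force
  next
    case (step y z)
    then have "(\<psi> y, \<psi> z) \<in> R" using assms(2) \<psi> by force
    then show ?case using step.IH by (rule trancl_into_trancl[rotated])
  qed
  ultimately show ?thesis unfolding acyclic_def by blast
qed

lemma forest_sum_reindex:
  assumes "inj_on \<phi> T" "S \<subseteq> T" "finite S" "R \<subseteq> T \<times> T"
  shows "forest_sum (map_prod \<phi> \<phi> ` R) (\<phi> ` T) (\<phi> ` S) w = forest_sum R T S (\<lambda>u v. w (\<phi> u) (\<phi> v))"
  using assms(3,2,4)
proof (induction S arbitrary: R rule: finite_induct)
  case empty
  then show ?case
    using acyclic_reindex[OF assms(1)] by (simp add: forest_sum_def farcs_def)
next
  case (insert x S)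
  have nin: "\<phi> x \<notin> \<phi> ` S"
    using insert.prems insert.hyps assms(1) by (auto simp: inj_on_def)
  have "forest_sum (map_prod \<phi> \<phi> ` R) (\<phi> ` T) (\<phi> ` insert x S) w
      = (\<Sum>v\<in>T. w (\<phi> x) (\<phi> v) * forest_sum (map_prod \<phi> \<phi> ` insert (x, v) R) (\<phi> ` T) (\<phi> ` S) w)"
    using insert.hyps nin by (simp add: forest_sum_insert sum.reindex[OF assms(1)])
  also have "\<dots> = (\<Sum>v\<in>T. w (\<phi> x) (\<phi> v) * forest_sum (insert (x, v) R) T S (\<lambda>u v. w (\<phi> u) (\<phi> v)))"
    using insert.prems insert.IH[of "insert (x, _) R"] by (intro sum.cong refl) simp
  also have "\<dots> = forest_sum R T (insert x S) (\<lambda>u v. w (\<phi> u) (\<phi> v))"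
    using insert.hyps by (simp add: forest_sum_insert)
  finally show ?case .
qed

section \<open>Oriented spanning trees as acyclic functions\<close>

lemma wf_digraph_with_proj_iff:
  "wf_digraph (with_proj T) \<longleftrightarrow> parcs T \<subseteq> pverts T \<times> pverts T"
  unfolding wf_digraph_wp_iff pair_wf_digraph_def by auto

text \<open>Every nonempty closed walk contains a cycle, so excluding cycles excludes all closed
  walks.\<close>

lemma forest_with_proj_iff:
  assumes "wf_digraph (with_proj T)"
  shows "forest (with_proj T) \<longleftrightarrow> acyclic (parcs T)"
proof -
  interpret wf_digraph "with_proj T" by fact
  have "(\<exists>p. cycle p) \<longleftrightarrow> (\<exists>u p. awalk u p u \<and> p \<noteq> [])"
    using closed_w_imp_cycle by (auto simp: closed_w_def cycle_def)
  also have "\<dots> \<longleftrightarrow> (\<exists>u. (u, u) \<in> (parcs T)\<^sup>+)"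
    using reachable1_awalk by simp
  finally show ?thesis by (simp add: forest_def acyclic_def)
qed

text \<open>The outdegrees make the arcs the graph of a function on the non-root vertices.
  Conversely, following an acyclic function on a finite set leads every vertex to \<open>r\<close>,
  which gives connectedness.\<close>

lemma oriented_spanning_trees_eq:
  assumes "pair_digraph G" "r \<in> pverts G"
  defines "S \<equiv> pverts G - {r}"
  shows "oriented_spanning_trees G r = (\<lambda>f. \<lparr>pverts = pverts G, parcs = farcs S f\<rparr>) `
    {f \<in> S \<rightarrow>\<^sub>E pverts G. acyclic (farcs S f) \<and> farcs S f \<subseteq> parcs G}" (is "_ = ?t ` ?A")
proof (intro equalityI subsetI)
  interpret G: pair_digraph G by fact
  have wfG: "wf_digraph (with_proj G)" by (simp add: wf_digraph_wp_iff G.pair_wf_digraph)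
  have finS: "finite S" using G.pair_finite_verts by (simp add: S_def)
  {
    fix T assume T: "T \<in> oriented_spanning_trees G r"
    have sg: "pverts T = pverts G" "parcs T \<subseteq> parcs G" and wfT: "wf_digraph (with_proj T)"
      and fo: "forest (with_proj T)" and d0: "out_degree (with_proj T) r = 0"
      and d1: "\<And>u. u \<in> S \<Longrightarrow> out_degree (with_proj T) u = 1"
      using T by (auto simp: oriented_spanning_trees_def spanning_tree_def spanning_def subgraph_def tree_def S_def)
    have finA: "finite (parcs T)" using sg G.pair_finite_arcs by (auto intro: finite_subset)
    have "\<exists>v. out_arcs (with_proj T) u = {(u, v)}" if u: "u \<in> S" for u
    proof -
      obtain e where e: "out_arcs (with_proj T) u = {e}"
        using d1[OF u] by (auto simp: out_degree_def card_1_singleton_iff)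
      then have "e \<in> out_arcs (with_proj T) u" by simp
      then have "fst e = u" by simp
      with e show ?thesis by (metis prod.collapse)
    qed
    then obtain f0 where f0: "\<And>u. u \<in> S \<Longrightarrow> out_arcs (with_proj T) u = {(u, f0 u)}" by metis
    have arcs_iff: "(u, v) \<in> parcs T \<longleftrightarrow> v = f0 u" if "u \<in> S" for u v
      using f0[OF that] by (auto simp: out_arcs_def set_eq_iff)
    \<comment> \<open>Outdegree zero excludes arcs out of \<open>r\<close> because the arc set is
      finite; an infinite set would have \<open>card\<close> zero too.\<close>
    have tail: "u \<in> S" if "(u, v) \<in> parcs T" for u v
    proof -
      have "(u, v) \<in> out_arcs (with_proj T) u" using that by simp
      then have "u \<noteq> r" using d0 finA by (auto simp: out_degree_def out_arcs_def)
      then show ?thesis using that wfT sg by (auto simp: S_def wf_digraph_with_proj_iff)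
    qed
    define f where "f = restrict f0 S"
    have parcs: "parcs T = farcs S f"
      using arcs_iff tail by (fastforce simp: farcs_def f_def)
    have "f0 u \<in> pverts G" if "u \<in> S" for u
      using arcs_iff[OF that, of "f0 u"] sg wfT by (auto simp: wf_digraph_with_proj_iff)
    then have "f \<in> S \<rightarrow>\<^sub>E pverts G" by (auto simp: f_def)
    moreover have "acyclic (farcs S f)"
      using fo forest_with_proj_iff[OF wfT] parcs by simp
    ultimately have "f \<in> ?A" using parcs sg by simp
    moreover have "T = ?t f" using sg parcs by simp
    ultimately show "T \<in> ?t ` ?A" by blast
  }
  {
    fix T assume "T \<in> ?t ` ?A"
    then obtain f where f: "f \<in> S \<rightarrow>\<^sub>E pverts G" "acyclic (farcs S f)" "farcs S f \<subseteq> parcs G"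
      and T: "T = ?t f" by auto
    have wfT: "wf_digraph (with_proj T)"
      using f(1) by (auto simp: wf_digraph_with_proj_iff T farcs_def S_def)
    interpret T: wf_digraph "with_proj T" by fact
    interpret sT: pair_wf_digraph "mk_symmetric (with_proj T)" ..
    have wf: "wf ((farcs S f)\<inverse>)"
      using f(2) finS by (intro finite_acyclic_wf_converse) (auto simp: farcs_def)
    have reach: "u \<rightarrow>\<^sup>*\<^bsub>with_proj T\<^esub> r" if "u \<in> pverts G" for u
      using that
    proof (induction u rule: wf_induct_rule[OF wf])
      case (1 u)
      show ?case
      proof (cases "u = r")
        case True
        then show ?thesis using T.reachable_refl[of r] assms(2) by (simp add: T)
      next
        case False
        then have "u \<in> S" using 1 by (simp add: S_def)
        then have "(u, f u) \<in> farcs S f" "f u \<in> pverts G" using f(1) by (auto simp: farcs_def)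
        then have "(u, f u) \<in> arcs_ends (with_proj T)" "f u \<rightarrow>\<^sup>*\<^bsub>with_proj T\<^esub> r"
          using 1 by (auto simp: T)
        then show ?thesis by (rule T.adj_reachable_trans)
      qed
    qed
    have "u \<rightarrow>\<^sup>*\<^bsub>with_proj (mk_symmetric (with_proj T))\<^esub> v" if "u \<in> pverts G" "v \<in> pverts G" for u v
    proof -
      have "u \<rightarrow>\<^sup>*\<^bsub>with_proj (mk_symmetric (with_proj T))\<^esub> r" "v \<rightarrow>\<^sup>*\<^bsub>with_proj (mk_symmetric (with_proj T))\<^esub> r"
        using reach that T.reachable_mk_symmetricI by auto
      moreover have "r \<rightarrow>\<^sup>*\<^bsub>with_proj (mk_symmetric (with_proj T))\<^esub> v"
        using calculation(2) symmetric_mk_symmetric by (rule symmetric_reachable[rotated])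
      ultimately show ?thesis using sT.reachable_trans by blast
    qed
    then have "connected (with_proj T)"
      using assms(2) by (intro T.connectedI) (auto simp: T)
    moreover have "forest (with_proj T)"
      using f(2) forest_with_proj_iff[OF wfT] by (simp add: T)
    moreover have "spanning (with_proj T) (with_proj G)"
      using wfT wfG f(3) by (auto simp: spanning_def subgraph_def T compatible_def)
    moreover have "out_degree (with_proj T) u = of_bool (u \<noteq> r)" if "u \<in> pverts G" for u
    proof -
      have "out_arcs (with_proj T) u = (if u = r then {} else {(u, f u)})"
        using that by (auto simp: out_arcs_def T farcs_def S_def)
      then show ?thesis by (simp add: out_degree_def)
    qed
    moreover have "pverts T = pverts G" by (simp add: T)
    ultimately show "T \<in> oriented_spanning_trees G r"
      using assms(2) by (simp add: oriented_spanning_trees_def spanning_tree_def tree_def)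
  }
qed

text \<open>The arc indicator annihilates every function that uses a non-arc, so the sum over trees
  extends to all functions.\<close>

lemma sum_oriented_spanning_trees:
  assumes "pair_digraph G" "r \<in> pverts G"
  shows "(\<Sum>T\<in>oriented_spanning_trees G r. \<Prod>(u, v)\<in>parcs T. h u v)
       = forest_sum {} (pverts G) (pverts G - {r}) (\<lambda>u v. of_bool ((u, v) \<in> parcs G) * h u v)"
proof -
  interpret G: pair_digraph G by fact
  define S where "S = pverts G - {r}"
  let ?A = "{f \<in> S \<rightarrow>\<^sub>E pverts G. acyclic (farcs S f) \<and> farcs S f \<subseteq> parcs G}"
  have fin: "finite S" "finite (S \<rightarrow>\<^sub>E pverts G)"
    using G.pair_finite_verts by (auto simp: S_def intro: finite_PiE)
  have inj: "inj_on (\<lambda>f. \<lparr>pverts = pverts G, parcs = farcs S f\<rparr>) ?A"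
  proof (rule inj_onI)
    fix f g assume fg: "f \<in> ?A" "g \<in> ?A" 
      and "\<lparr>pverts = pverts G, parcs = farcs S f\<rparr> = \<lparr>pverts = pverts G, parcs = farcs S g\<rparr>"
    then have "farcs S f = farcs S g" by simp
    then have "f u = g u" if "u \<in> S" for u using that by (auto simp: farcs_def)
    then show "f = g" using fg by (auto intro!: PiE_ext[of f S _ g])
  qed
  have "(\<Sum>T\<in>oriented_spanning_trees G r. \<Prod>(u, v)\<in>parcs T. h u v)
      = (\<Sum>f\<in>?A. \<Prod>(u, v)\<in>farcs S f. h u v)"
    unfolding oriented_spanning_trees_eq[OF assms] S_def[symmetric] by (subst sum.reindex[OF inj]) simp
  also have "\<dots> = (\<Sum>f\<in>?A. \<Prod>u\<in>S. h u (f u))"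
    unfolding farcs_def by (intro sum.cong refl, subst prod.reindex) (auto simp: inj_on_def)
  also have "\<dots> = (\<Sum>f\<in>?A. of_bool (acyclic ({} \<union> farcs S f)) * (\<Prod>u\<in>S. of_bool ((u, f u) \<in> parcs G) * h u (f u)))"
    by (intro sum.cong refl) (auto intro!: prod.cong simp: farcs_def)
  also have "\<dots> = forest_sum {} (pverts G) S (\<lambda>u v. of_bool ((u, v) \<in> parcs G) * h u v)"
    unfolding forest_sum_def
  proof (intro sum.mono_neutral_left fin ballI)
    fix f assume f: "f \<in> (S \<rightarrow>\<^sub>E pverts G) - ?A"
    show "of_bool (acyclic ({} \<union> farcs S f)) * (\<Prod>u\<in>S. of_bool ((u, f u) \<in> parcs G) * h u (f u)) = 0"
    proof (cases "acyclic (farcs S f)")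
      case True
      then obtain u where "u \<in> S" "(u, f u) \<notin> parcs G" using f by (auto simp: farcs_def)
      then have "(\<Prod>u\<in>S. of_bool ((u, f u) \<in> parcs G) * h u (f u)) = 0"
        using fin by (intro prod_zero) auto
      then show ?thesis by simp
    qed simp
  qed auto
  finally show ?thesis by (simp add: S_def)
qed

lemma num_oriented_spanning_trees_eq:
  assumes "pair_digraph G" "r \<in> pverts G"
  shows "real (num_oriented_spanning_trees G r)
       = forest_sum {} (pverts G) (pverts G - {r}) (\<lambda>u v. of_bool ((u, v) \<in> parcs G))"
  using sum_oriented_spanning_trees[OF assms, of "\<lambda>_ _. 1"]
  by (simp add: num_oriented_spanning_trees_def case_prod_unfold)

section \<open>Joins of stars\<close>

text \<open>Both formulas at once with denominators cleared; the indicator of \<open>p = 1\<close>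
  carries the extra summand for a central root.\<close>

lemma num_oriented_spanning_trees_join_stars:
  fixes G :: "'a pair_pre_digraph"
  assumes G: "pair_digraph G" and m: "\<And>i. i \<in> pverts G \<Longrightarrow> 1 \<le> m i"
    and i\<^sub>0: "i\<^sub>0 \<in> pverts G" and p: "1 \<le> p" "p \<le> m i\<^sub>0"
  shows "real (m i\<^sub>0) * (1 + real (out_weight G m i\<^sub>0)) *
      real (num_oriented_spanning_trees (generalized_join G (\<lambda>i. oriented_star (m i))) (i\<^sub>0, p))
    = (real (m i\<^sub>0) * of_bool (p = 1) + real (out_weight G m i\<^sub>0))
      * (\<Prod>i\<in>pverts G. (1 + real (out_weight G m i)) ^ (m i - 1))
      * (\<Sum>T\<in>oriented_spanning_trees G i\<^sub>0. \<Prod>(i, j)\<in>parcs T. real (m j))"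
proof -
  interpret G: pair_digraph G by fact
  let ?J = "generalized_join G (\<lambda>i. oriented_star (m i))"
  define V where "V = pverts G"
  define r where "r = (i\<^sub>0, p)"
  define VJ where "VJ = (SIGMA i:V. {1..m i})"
  define a :: "'a \<Rightarrow> 'a \<Rightarrow> real" where "a i j = of_bool ((i, j) \<in> parcs G)" for i j
  \<comment> \<open>The indicator is the arc from a leaf to its centre, \<open>a\<close> the arcs
    between different stars; they never overlap because \<open>a i i = 0\<close>.\<close>
  define w :: "'a \<times> nat \<Rightarrow> 'a \<times> nat \<Rightarrow> real" where
    "w u v = of_bool (fst u = fst v \<and> snd v = 1 \<and> snd u \<noteq> 1) + a (fst u) (fst v)" for u v
  define z where "z i = real (out_weight G m i)" for i
  define k where "k i = (if i = i\<^sub>0 \<and> p = 1 \<and> 2 \<le> m i\<^sub>0 then 2 else 1 :: nat)" for i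
  \<comment> \<open>\<open>(i, k i)\<close> represents star \<open>i\<close> and \<open>Q i\<close> are the vertices absorbed into it. It is the centre,
    unless that is the root; then it is a leaf if there is one, and otherwise the root itself.\<close>
  define Q where "Q i = {1..m i} - {k i} - (if i = i\<^sub>0 then {p} else {})" for i
  define rp where "rp i = (i, k i)" for i
  define X where "X = (SIGMA i:V. Q i)"
  define w2 where "w2 u v = w u v + (\<Sum>x | x \<in> X \<and> rp (fst x) = v. w u x)" for u v
  define t where "t = forest_sum {} V (V - {i\<^sub>0}) (\<lambda>i j. a i j * real (m j))"

  have finV: "finite V" and i0V: "i\<^sub>0 \<in> V" and m1: "\<And>i. i \<in> V \<Longrightarrow> 1 \<le> m i"
    using G.pair_finite_verts i\<^sub>0 m by (auto simp: V_def)
  have fin: "finite VJ" "finite X" "finite (Q i)" for i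
    using finV by (auto simp: VJ_def X_def Q_def)
  have arcV: "(i, j) \<in> parcs G \<Longrightarrow> i \<in> V \<and> j \<in> V \<and> i \<noteq> j" for i j
    using G.in_arcsD1 G.in_arcsD2 G.pair_no_loops[of "(i, j)"] by (auto simp: V_def)
  have a_self: "a i i = 0" for i using arcV by (auto simp: a_def)
  have z_eq: "z i = (\<Sum>j\<in>V. real (m j) * a i j)" for i
  proof -
    have "(\<Sum>j\<in>V. real (m j) * a i j) = (\<Sum>j\<in>{j \<in> V. (i, j) \<in> parcs G}. real (m j))"
      using finV by (simp add: a_def of_bool_def if_distrib[of "\<lambda>c. _ * c"] sum.inter_filter cong: if_cong)
    also have "{j \<in> V. (i, j) \<in> parcs G} = {j. (i, j) \<in> parcs G}" using arcV by auto
    finally show ?thesis by (simp add: z_def out_weight_def)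
  qed
  have tsum: "(\<Sum>T\<in>oriented_spanning_trees G i\<^sub>0. \<Prod>(i, j)\<in>parcs T. real (m j)) = t"
    unfolding t_def V_def a_def by (rule sum_oriented_spanning_trees[OF G i\<^sub>0])

  \<comment> \<open>The tree count of the join as a forest sum\<close>
  have kV: "k i \<in> {1..m i}" if "i \<in> V" for i using m1[OF that] by (auto simp: k_def)
  have rVJ: "r \<in> VJ" using i0V p by (auto simp: r_def VJ_def)
  have num: "real (num_oriented_spanning_trees ?J (i\<^sub>0, p)) = forest_sum {} VJ (VJ - {r}) w"
  proof -
    have J: "pair_digraph ?J"
      by (intro pair_digraph_generalized_join G pair_digraph_oriented_star)
    have verts: "pverts ?J = VJ"
      by (simp add: generalized_join_def VJ_def V_def oriented_star_def)
    have arcs: "of_bool ((u, v) \<in> parcs ?J) = w u v" if "u \<in> VJ" "v \<in> VJ" for u v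
      using that arcV
      by (cases u; cases v) (auto simp: generalized_join_def VJ_def V_def oriented_star_def w_def a_def)
    show ?thesis
      using num_oriented_spanning_trees_eq[OF J, of "(i\<^sub>0, p)"] rVJ arcs
      by (auto simp: verts r_def[symmetric] intro!: forest_sum_cong)
  qed

  \<comment> \<open>Collapsing each star onto its representative\<close>
  have Q1: "q \<noteq> 1" if "q \<in> Q i" for i q
    using that by (auto simp: Q_def k_def split: if_splits)
  \<comment> \<open>In star \<open>i\<^sub>0\<close> both the root and the representative stay. They
    coincide only if \<open>m i\<^sub>0 = 1\<close>, where truncated subtraction still gives the
    right value zero.\<close>
  have cardQ: "card (Q i) = (if i = i\<^sub>0 then m i - 2 else m i - 1)" if "i \<in> V" for i
  proof (cases "i = i\<^sub>0")
    case True
    show ?thesis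
    proof (cases "k i = p")
      case eq: True
      then have "m i = 1" using True p m1[OF that] by (auto simp: k_def split: if_splits)
      then show ?thesis using True eq kV[OF that] by (simp add: Q_def)
    next
      case False
      then show ?thesis using True p kV[OF that] by (simp add: Q_def)
    qed
  next
    case False
    then show ?thesis using kV[OF that] by (simp add: Q_def)
  qed
  have row_total: "(\<Sum>v\<in>VJ. w (rp i) v) = of_bool (k i \<noteq> 1) + z i" if "i \<in> V" for i
  proof -
    have "(\<Sum>v\<in>VJ. w (rp i) v) = (\<Sum>j\<in>V. \<Sum>q\<in>{1..m j}. of_bool (i = j \<and> q = 1 \<and> k i \<noteq> 1) + a i j)"
      unfolding VJ_def using finV by (subst sum.Sigma) (auto simp: w_def rp_def case_prod_unfold)
    also have "\<dots> = (\<Sum>j\<in>V. of_bool (i = j \<and> k i \<noteq> 1) + real (m j) * a i j)"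
    proof (rule sum.cong[OF refl])
      fix j assume "j \<in> V"
      have "(\<Sum>q\<in>{1..m j}. of_bool (i = j \<and> q = 1 \<and> k i \<noteq> 1)) = (\<Sum>q\<in>{1..m j}. if q = 1 then of_bool (i = j \<and> k i \<noteq> 1) else 0 :: real)"
        by (intro sum.cong) auto
      then show "(\<Sum>q\<in>{1..m j}. of_bool (i = j \<and> q = 1 \<and> k i \<noteq> 1) + a i j) = of_bool (i = j \<and> k i \<noteq> 1) + real (m j) * a i j"
        using m1[OF \<open>j \<in> V\<close>] by (simp add: sum.distrib)
    qed
    also have "\<dots> = of_bool (k i \<noteq> 1) + z i"
    proof -
      have "(\<Sum>j\<in>V. of_bool (i = j \<and> k i \<noteq> 1)) = (\<Sum>j\<in>V. if j = i then of_bool (k i \<noteq> 1) else 0 :: real)"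
        by (intro sum.cong) auto
      then show ?thesis using that finV by (simp add: sum.distrib z_eq)
    qed
    finally show ?thesis .
  qed

  \<comment> \<open>If the representative is the centre, a leaf has the arc to it in addition; if it
    is a leaf, the rows agree and already contain the arc to the centre. Either way each absorbed
    vertex yields a factor \<open>1 + z i\<close>.\<close>
  have collapse: "forest_sum {} VJ (VJ - {r}) w
      = (\<Prod>x\<in>X. of_bool (k (fst x) = 1) + (\<Sum>v\<in>VJ. w (rp (fst x)) v)) * forest_sum {} (VJ - X) (VJ - {r} - X) w2"
    unfolding w2_def
  proof (rule forest_sum_collapse)
    show "X \<subseteq> VJ - {r}" by (auto simp: X_def VJ_def Q_def r_def)
    show "rp (fst x) \<in> VJ - {r} - X" if xX: "x \<in> X" for x
    proof -
      obtain i q where x: "x = (i, q)" "i \<in> V" "q \<in> Q i" using xX by (auto simp: X_def)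
      then have "rp i \<noteq> r" using m1[of i] p by (auto simp: rp_def r_def Q_def k_def split: if_splits)
      then show ?thesis using x kV by (auto simp: rp_def VJ_def X_def Q_def)
    qed
    show "w x v = of_bool (k (fst x) = 1) * of_bool (v = rp (fst x)) + w (rp (fst x)) v" if "x \<in> X" for x v
      using that Q1 by (cases x; cases v) (auto simp: X_def w_def rp_def)
  qed (use fin in auto)
  have prodX: "(\<Prod>x\<in>X. of_bool (k (fst x) = 1) + (\<Sum>v\<in>VJ. w (rp (fst x)) v)) = (\<Prod>i\<in>V. (1 + z i) ^ card (Q i))"
  proof -
    have "(\<Prod>x\<in>X. of_bool (k (fst x) = 1) + (\<Sum>v\<in>VJ. w (rp (fst x)) v)) = (\<Prod>x\<in>X. 1 + z (fst x))"
      by (intro prod.cong refl) (auto simp: X_def row_total)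
    also have "\<dots> = (\<Prod>i\<in>V. \<Prod>q\<in>Q i. 1 + z i)"
      unfolding X_def using finV fin by (subst prod.Sigma) (auto simp: case_prod_unfold)
    finally show ?thesis by simp
  qed

  \<comment> \<open>The forest sum of the collapsed digraph\<close>
  \<comment> \<open>No star arc joins two representatives or a representative to an absorbed vertex,
    so only copies of the arc of \<open>G\<close> are added up.\<close>
  have w2_rp: "w2 (rp i) (rp j) = real (1 + card (Q j)) * a i j" if "j \<in> V" for i j
  proof -
    have "{x. x \<in> X \<and> rp (fst x) = rp j} = Pair j ` Q j"
      using that by (auto simp: X_def rp_def)
    then have "(\<Sum>x | x \<in> X \<and> rp (fst x) = rp j. w (rp i) x) = (\<Sum>q\<in>Q j. w (rp i) (j, q))"
      by (simp add: sum.reindex inj_on_def)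
    also have "\<dots> = (\<Sum>q\<in>Q j. a i j)"
      using Q1 by (intro sum.cong) (auto simp: w_def rp_def)
    finally show ?thesis
      by (auto simp: w2_def w_def rp_def algebra_simps)
  qed
  have verts2: "VJ - X = insert r (rp ` V)"
    using kV rVJ by (auto simp: VJ_def X_def Q_def rp_def r_def split: if_splits)
  have fst_rp: "fst (rp i) = i" for i by (simp add: rp_def)
  have inj_rp: "inj_on rp V" by (auto simp: inj_on_def rp_def)

  \<comment> \<open>For \<open>m i\<^sub>0 = 1\<close> the extra factor
    \<open>1 + z i\<^sub>0\<close> is the numerator; otherwise it supplies the exponent lost because
    two vertices of star \<open>i\<^sub>0\<close> were kept.\<close>
  have reduced: "real (m i\<^sub>0) * forest_sum {} (VJ - X) (VJ - {r} - X) w2 * (1 + z i\<^sub>0) ^ card (Q i\<^sub>0) * (1 + z i\<^sub>0)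
      = (real (m i\<^sub>0) * of_bool (p = 1) + z i\<^sub>0) * t * (1 + z i\<^sub>0) ^ (m i\<^sub>0 - 1)"
  proof (cases "2 \<le> m i\<^sub>0")
    case False
    then have 1: "m i\<^sub>0 = 1" "p = 1" using m1[OF i0V] p by auto
    then have r: "r = rp i\<^sub>0" by (simp add: r_def rp_def k_def)
    have S2: "VJ - {r} - X = rp ` (V - {i\<^sub>0})" and T2: "VJ - X = rp ` V"
      using verts2 inj_rp i0V by (auto simp: r inj_on_def)
    have "forest_sum {} (VJ - X) (VJ - {r} - X) w2 = forest_sum {} V (V - {i\<^sub>0}) (\<lambda>i j. w2 (rp i) (rp j))"
      unfolding S2 T2 using forest_sum_reindex[OF inj_rp, of "V - {i\<^sub>0}" "{}" w2] finV by auto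
    also have "\<dots> = t"
      unfolding t_def using m1 by (intro forest_sum_cong) (auto simp: w2_rp cardQ 1 of_nat_diff)
    finally show ?thesis using 1 cardQ[OF i0V] by simp
  next
    case True
    have kp: "k i\<^sub>0 \<noteq> p" using p True by (auto simp: k_def)
    have r: "r \<notin> rp ` V" using kp by (auto simp: r_def rp_def)
    have S2: "VJ - {r} - X = rp ` V" using verts2 r by auto
    have w2_r: "w2 u r = w u r" for u
    proof -
      have "{x. x \<in> X \<and> rp (fst x) = r} = {}" using r by (auto simp: X_def)
      then show ?thesis unfolding w2_def by (simp only: sum.empty add_0_right)
    qed
    let ?S = "rp ` V - {rp i\<^sub>0}"
    \<comment> \<open>After the hub step the root alone stands for star
      \<open>i\<^sub>0\<close>.\<close>
    define \<phi> where "\<phi> i = (if i = i\<^sub>0 then r else rp i)" for i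
    have inj_\<phi>: "inj_on \<phi> V" using inj_rp r by (auto simp: inj_on_def \<phi>_def)
    have S3: "?S = \<phi> ` (V - {i\<^sub>0})" and T3: "insert r ?S = \<phi> ` V"
      using inj_rp i0V by (auto simp: \<phi>_def inj_on_def)
    let ?w3 = "\<lambda>u v. if v = r then (real (m i\<^sub>0 - 1) + 1) * a (fst u) i\<^sub>0 else w2 u v"
    have z2: "(\<Sum>v\<in>?S. w2 (rp i\<^sub>0) v) = z i\<^sub>0"
    proof -
      have "?S = rp ` (V - {i\<^sub>0})" using inj_rp i0V by (auto simp: inj_on_def)
      then have "(\<Sum>v\<in>?S. w2 (rp i\<^sub>0) v) = (\<Sum>j\<in>V - {i\<^sub>0}. w2 (rp i\<^sub>0) (rp j))"
        using inj_rp by (simp add: sum.reindex inj_on_diff)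
      also have "\<dots> = (\<Sum>j\<in>V - {i\<^sub>0}. real (m j) * a i\<^sub>0 j)"
        using m1 by (intro sum.cong) (auto simp: w2_rp cardQ of_nat_diff)
      also have "\<dots> = z i\<^sub>0"
        using finV i0V by (simp add: z_eq sum.remove[of V i\<^sub>0] a_self)
      finally show ?thesis .
    qed
    \<comment> \<open>The ratio is \<open>m i\<^sub>0 - 1\<close> to 1, as
      \<open>rp i\<^sub>0\<close> now stands for all vertices of its star but the root. Position 0
      is free for the auxiliary vertex, since star vertices are numbered from 1.\<close>
    have "(real (m i\<^sub>0 - 1) + 1) * forest_sum {} (insert r (rp ` V)) (rp ` V) w2
        = ((real (m i\<^sub>0 - 1) + 1) * w2 (rp i\<^sub>0) r + 1 * (\<Sum>v\<in>?S. w2 (rp i\<^sub>0) v)) * forest_sum {} (insert r ?S) ?S ?w3"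
    proof (rule forest_sum_hub[where s = "(i\<^sub>0, 0)"])
      show "(i\<^sub>0, 0) \<notin> insert r (rp ` V)" using p by (auto simp: r_def rp_def k_def split: if_splits)
      show "w2 (rp i\<^sub>0) (rp i\<^sub>0) = 0" using i0V by (simp add: w2_rp a_self)
      show "w2 u (rp i\<^sub>0) = real (m i\<^sub>0 - 1) * a (fst u) i\<^sub>0" if "u \<in> rp ` V" for u
        using that i0V True by (auto simp: w2_rp cardQ fst_rp)
      show "w2 u r = 1 * a (fst u) i\<^sub>0" if "u \<in> rp ` V" "u \<noteq> rp i\<^sub>0" for u
        using that unfolding w2_r by (auto simp: w_def r_def rp_def)
    qed (use finV i0V r in auto)
    moreover have "forest_sum {} (insert r ?S) ?S ?w3 = t"
    proof -
      have "forest_sum {} (insert r ?S) ?S ?w3 = forest_sum {} V (V - {i\<^sub>0}) (\<lambda>i j. ?w3 (\<phi> i) (\<phi> j))"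
        unfolding T3 unfolding S3 using forest_sum_reindex[OF inj_\<phi>, of "V - {i\<^sub>0}" "{}" ?w3] finV by auto
      also have "\<dots> = t"
        unfolding t_def
      proof (rule forest_sum_cong)
        fix i j assume ij: "i \<in> V - {i\<^sub>0}" "j \<in> V"
        have "\<phi> j = r \<longleftrightarrow> j = i\<^sub>0" using r ij by (auto simp: \<phi>_def)
        moreover have "\<phi> i = rp i" "fst (rp i) = i" using ij by (auto simp: \<phi>_def rp_def)
        ultimately show "?w3 (\<phi> i) (\<phi> j) = a i j * real (m j)"
          using ij m1[of j] by (auto simp: \<phi>_def w2_rp cardQ of_nat_diff)
      qed
      finally show ?thesis .
    qed
    \<comment> \<open>If the root is the centre, the representative is a leaf with an arc to it;
      otherwise it is the centre, which has no arc to a leaf.\<close>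
    moreover have "w2 (rp i\<^sub>0) r = of_bool (p = 1)"
      using True unfolding w2_r by (auto simp: w_def r_def rp_def a_self k_def)
    moreover have "real (m i\<^sub>0 - 1) + 1 = real (m i\<^sub>0)" using True by (simp add: of_nat_diff)
    ultimately have "real (m i\<^sub>0) * forest_sum {} (VJ - X) (VJ - {r} - X) w2
        = (real (m i\<^sub>0) * of_bool (p = 1) + z i\<^sub>0) * t"
      unfolding S2 verts2 using z2 by simp
    moreover have "(1 + z i\<^sub>0) ^ card (Q i\<^sub>0) * (1 + z i\<^sub>0) = (1 + z i\<^sub>0) ^ (m i\<^sub>0 - 1)"
    proof -
      have "m i\<^sub>0 - 1 = Suc (m i\<^sub>0 - 2)" using True by simp
      then show ?thesis using cardQ[OF i0V] by (simp only: power_Suc2 refl if_True)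
    qed
    ultimately show ?thesis by (simp add: mult.assoc)
  qed

  have others: "(\<Prod>i\<in>V - {i\<^sub>0}. (1 + z i) ^ card (Q i)) = (\<Prod>i\<in>V - {i\<^sub>0}. (1 + z i) ^ (m i - 1))" (is "?P = _")
    by (intro prod.cong) (auto simp: cardQ)
  have "real (m i\<^sub>0) * (1 + z i\<^sub>0) * forest_sum {} VJ (VJ - {r}) w
      = (real (m i\<^sub>0) * forest_sum {} (VJ - X) (VJ - {r} - X) w2 * (1 + z i\<^sub>0) ^ card (Q i\<^sub>0) * (1 + z i\<^sub>0)) * ?P"
    unfolding collapse prodX using finV i0V by (simp add: prod.remove[of V i\<^sub>0] mult_ac)
  also have "\<dots> = (real (m i\<^sub>0) * of_bool (p = 1) + z i\<^sub>0) * (\<Prod>i\<in>V. (1 + z i) ^ (m i - 1)) * t"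
    unfolding reduced others using finV i0V by (simp add: prod.remove[of V i\<^sub>0] mult_ac)
  finally show ?thesis
    unfolding num tsum by (simp add: z_def V_def)
qed

theorem theorem4p6:
  fixes G :: "nat pair_pre_digraph" and n :: nat and m :: "nat \<Rightarrow> nat" and i\<^sub>0 :: nat
  assumes "pair_digraph G"
    and "pverts G = {1..n}"
    and "\<And>i. i \<in> pverts G \<Longrightarrow> 1 \<le> m i"
    and "i\<^sub>0 \<in> pverts G"
  shows
    "real (num_oriented_spanning_trees (generalized_join G (\<lambda>i. oriented_star (m i))) (i\<^sub>0, 1))
       = (real (m i\<^sub>0) + real (out_weight G m i\<^sub>0))
           / (real (m i\<^sub>0) + real (m i\<^sub>0) * real (out_weight G m i\<^sub>0))
         * (\<Prod>i\<in>pverts G. (1 + real (out_weight G m i)) ^ (m i - 1))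
         * (\<Sum>T\<in>oriented_spanning_trees G i\<^sub>0. \<Prod>(i, j)\<in>parcs T. real (m j))
     \<and> (\<forall>p. 2 \<le> p \<and> p \<le> m i\<^sub>0 \<longrightarrow>
       real (num_oriented_spanning_trees (generalized_join G (\<lambda>i. oriented_star (m i))) (i\<^sub>0, p))
       = real (out_weight G m i\<^sub>0)
           / (real (m i\<^sub>0) + real (m i\<^sub>0) * real (out_weight G m i\<^sub>0))
         * (\<Prod>i\<in>pverts G. (1 + real (out_weight G m i)) ^ (m i - 1))
         * (\<Sum>T\<in>oriented_spanning_trees G i\<^sub>0. \<Prod>(i, j)\<in>parcs T. real (m j)))"
proof -
  note main = num_oriented_spanning_trees_join_stars[where m = m, OF assms(1,3,4)]
  have m: "1 \<le> m i\<^sub>0" using assms(3,4) by blast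
  then have "real (m i\<^sub>0) + real (m i\<^sub>0) * real (out_weight G m i\<^sub>0) > 0"
    by (intro add_pos_nonneg) auto
  then have div: "t = c / (real (m i\<^sub>0) + real (m i\<^sub>0) * real (out_weight G m i\<^sub>0)) * P * T"
    if "real (m i\<^sub>0) * (1 + real (out_weight G m i\<^sub>0)) * t = c * P * T" for t c P T
    using that by (simp add: field_simps)
  show ?thesis
    using main[where p = 1] m main by (intro conjI allI impI div) auto
qed

end
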